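(* If $n\ge 5$ is an odd integer, then $$\chi(Q_{n}^{[\natural n-3]})\le \chi(J(n,(n-3)/2,0))+\chi(J(n,(n-1)/2,1))+1\le \chi(K(7,3,1))+6.$$
   Context: $Q_n^{[\natural p]}$ is the graph on $\{0,1\}^n$ in which two vertices are adjacent iff they differ in exactly $p$ coordinates. For integers $i\le k\le n$, the generalized Johnson graph $J(n,k,i)$ has vertex set $\{A\subseteq\{1,\ldots,n\}: |A|=k\}$ and edge set $\{AB: |A\cap B|=i\}$; the generalized Kneser graph $K(n,k,i)$ has the same vertex set, two distinct vertices $A,B$ being adjacent iff $|A\cap B|\le i$. $\chi$ denotes the chromatic number. *)

theory Defs
  imports Main "HOL-Library.FuncSet"
begin

text \<open>A simple graph is given by its vertex set and its set of two-element edges.\<close>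

type_synonym 'a graph = "'a set \<times> 'a set set"

abbreviation verts :: "'a graph \<Rightarrow> 'a set" where "verts G \<equiv> fst G"

abbreviation edges :: "'a graph \<Rightarrow> 'a set set" where "edges G \<equiv> snd G"

definition proper_coloring :: "'a graph \<Rightarrow> nat \<Rightarrow> ('a \<Rightarrow> nat) \<Rightarrow> bool" where
  "proper_coloring G k c \<longleftrightarrow>
     (\<forall>v \<in> verts G. c v < k) \<and>
     (\<forall>u \<in> verts G. \<forall>v \<in> verts G. {u, v} \<in> edges G \<longrightarrow> c u \<noteq> c v)"

definition chromatic_number :: "'a graph \<Rightarrow> nat" where
  "chromatic_number G = (LEAST k. \<exists>c. proper_coloring G k c)"

text \<open>On finite loopless graphs, such as all those below, the least element exists.\<close>

lemma proper_coloring_chromatic_number: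
  assumes "finite (verts G)" and "\<And>v. {v} \<notin> edges G"
  shows "\<exists>c. proper_coloring G (chromatic_number G) c"
proof -
  obtain c where "bij_betw c (verts G) {0..<card (verts G)}"
    using ex_bij_betw_finite_nat[OF assms(1)] by blast
  then have "proper_coloring G (card (verts G)) c"
    using assms(2) by (fastforce simp: proper_coloring_def bij_betw_def inj_on_def)
  then have "\<exists>c. proper_coloring G (card (verts G)) c" by blast
  then show ?thesis
    unfolding chromatic_number_def by (rule LeastI)
qed

definition cube_distance_graph :: "nat \<Rightarrow> nat \<Rightarrow> (nat \<Rightarrow> nat) graph" where
  "cube_distance_graph n p =
     (let V = {1..n} \<rightarrow>\<^sub>E {0, 1}
      in (V, {{x, y} |x y. x \<in> V \<and> y \<in> V \<and> x \<noteq> y \<and> card {j \<in> {1..n}. x j \<noteq> y j} = p}))"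

definition johnson_graph :: "nat \<Rightarrow> nat \<Rightarrow> nat \<Rightarrow> nat set graph" where
  "johnson_graph n k i =
     (let V = {A. A \<subseteq> {1..n} \<and> card A = k}
      in (V, {{A, B} |A B. A \<in> V \<and> B \<in> V \<and> A \<noteq> B \<and> card (A \<inter> B) = i}))"

definition kneser_graph :: "nat \<Rightarrow> nat \<Rightarrow> nat \<Rightarrow> nat set graph" where
  "kneser_graph n k i =
     (let V = {A. A \<subseteq> {1..n} \<and> card A = k}
      in (V, {{A, B} |A B. A \<in> V \<and> B \<in> V \<and> A \<noteq> B \<and> card (A \<inter> B) \<le> i}))"

end

theory Submission
  imports Defs
begin

text \<open>
  Write \<open>n = 2 m + 1\<close>. Since \<open>n - 3\<close> is even, sets at distance \<open>n - 3\<close> have sizes of equal parity,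
  and complementation, which preserves distances, exchanges the two parities as \<open>n\<close> is odd. So it
  suffices to colour the sets whose size has the parity of \<open>m - 1\<close>. Distances among
  the sets of size at most \<open>m - 1\<close> reach \<open>2 m - 2\<close> only for disjoint sets of size exactly \<open>m - 1\<close>;
  the sets of size \<open>m + 1\<close> induce, via complements, \<open>J(n, m, 1)\<close>; and the sets of size at least
  \<open>m + 3\<close> are pairwise at distance at most \<open>2 m - 4\<close>, so one colour suffices for them.

  For the second inequality, \<open>J(n, m - 1, 0)\<close> is a Kneser graph and has the classical colouring with
  five colours, while \<open>J(n, m, 1)\<close> is a subgraph of \<open>K(2 m + 1, m, 1)\<close>, which for \<open>m \<ge> 3\<close> maps to
  \<open>K(7, 3, 1)\<close> by iterating a homomorphism \<open>K(n + 2, k + 1, i) \<rightarrow> K(n, k, i)\<close> in the style of Stahl.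
  For \<open>m = 2\<close> five colours suffice for \<open>J(5, 2, 1)\<close>, and the Fano plane is a clique of size \<open>7\<close>
  in \<open>K(7, 3, 1)\<close>.
\<close>

section \<open>Bounds on the chromatic number from colourings, homomorphisms and cliques\<close>

lemma chromatic_number_le:
  assumes "proper_coloring G k c"
  shows "chromatic_number G \<le> k"
  unfolding chromatic_number_def using assms by (blast intro: Least_le)

lemma chromatic_number_hom_le:
  assumes "finite (verts H)" and "\<And>v. {v} \<notin> edges H"
    and "\<And>v. v \<in> verts G \<Longrightarrow> f v \<in> verts H"
    and "\<And>u v. \<lbrakk>u \<in> verts G; v \<in> verts G; {u, v} \<in> edges G\<rbrakk> \<Longrightarrow> {f u, f v} \<in> edges H"
  shows "chromatic_number G \<le> chromatic_number H"
proof -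
  obtain c where "proper_coloring H (chromatic_number H) c"
    using proper_coloring_chromatic_number[OF assms(1,2)] by blast
  then have "proper_coloring G (chromatic_number H) (c \<circ> f)"
    using assms(3,4) by (simp add: proper_coloring_def)
  then show ?thesis by (rule chromatic_number_le)
qed

lemma clique_le_chromatic_number:
  assumes "finite (verts G)" and "\<And>v. {v} \<notin> edges G"
    and "C \<subseteq> verts G" and "\<And>u v. \<lbrakk>u \<in> C; v \<in> C; u \<noteq> v\<rbrakk> \<Longrightarrow> {u, v} \<in> edges G"
  shows "card C \<le> chromatic_number G"
proof -
  obtain c where c: "proper_coloring G (chromatic_number G) c"
    using proper_coloring_chromatic_number[OF assms(1,2)] by blast
  have "inj_on c C"
    using c assms(3,4) unfolding proper_coloring_def inj_on_def by blast
  moreover have "c ` C \<subseteq> {..<chromatic_number G}"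
    using c assms(3) by (auto simp: proper_coloring_def)
  ultimately show ?thesis
    using card_inj_on_le[of c C "{..<chromatic_number G}"] by simp
qed

section \<open>Vertices and edges of the three families of graphs\<close>

lemma verts_johnson_graph: "verts (johnson_graph n k i) = {A. A \<subseteq> {1..n} \<and> card A = k}"
  by (simp add: johnson_graph_def Let_def)

lemma verts_kneser_graph: "verts (kneser_graph n k i) = {A. A \<subseteq> {1..n} \<and> card A = k}"
  by (simp add: kneser_graph_def Let_def)

lemma verts_cube_distance_graph: "verts (cube_distance_graph n p) = {1..n} \<rightarrow>\<^sub>E {0, 1}"
  by (simp add: cube_distance_graph_def Let_def)

lemma edge_johnson_graph_iff:
  "{A, B} \<in> edges (johnson_graph n k i) \<longleftrightarrow>
     A \<in> verts (johnson_graph n k i) \<and> B \<in> verts (johnson_graph n k i) \<and> A \<noteq> B \<and> card (A \<inter> B) = i"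
  by (auto simp: johnson_graph_def Let_def doubleton_eq_iff Int_commute)

lemma edge_kneser_graph_iff:
  "{A, B} \<in> edges (kneser_graph n k i) \<longleftrightarrow>
     A \<in> verts (kneser_graph n k i) \<and> B \<in> verts (kneser_graph n k i) \<and> A \<noteq> B \<and> card (A \<inter> B) \<le> i"
  by (auto simp: kneser_graph_def Let_def doubleton_eq_iff Int_commute)

lemma edge_cube_distance_graphD:
  assumes "{x, y} \<in> edges (cube_distance_graph n p)"
  shows "card {j \<in> {1..n}. x j \<noteq> y j} = p"
proof -
  have "{j \<in> {1..n}. x j \<noteq> y j} = {j \<in> {1..n}. y j \<noteq> x j}" by auto
  then show ?thesis
    using assms by (auto simp: cube_distance_graph_def Let_def doubleton_eq_iff)
qed

lemma finite_verts_johnson_graph: "finite (verts (johnson_graph n k i))"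
  by (simp add: verts_johnson_graph)

lemma finite_verts_kneser_graph: "finite (verts (kneser_graph n k i))"
  by (simp add: verts_kneser_graph)

lemma loopless_johnson_graph: "{A} \<notin> edges (johnson_graph n k i)"
  using edge_johnson_graph_iff[of A A] by simp

lemma loopless_kneser_graph: "{A} \<notin> edges (kneser_graph n k i)"
  using edge_kneser_graph_iff[of A A] by simp

lemma johnson_le_kneser:
  "chromatic_number (johnson_graph n k i) \<le> chromatic_number (kneser_graph n k i)"
  by (rule chromatic_number_hom_le[where f = id, OF finite_verts_kneser_graph loopless_kneser_graph])
    (auto simp: edge_johnson_graph_iff edge_kneser_graph_iff verts_johnson_graph verts_kneser_graph)

lemma card_sym_diff:
  assumes "finite A" and "finite B"
  shows "card (sym_diff A B) + 2 * card (A \<inter> B) = card A + card B"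
proof -
  have "card (sym_diff A B) = card (A - B) + card (B - A)"
    using assms by (intro card_Un_disjoint) auto
  moreover have "card A = card (A - B) + card (A \<inter> B)"
    using assms by (metis card_Int_Diff add.commute)
  moreover have "card B = card (B - A) + card (A \<inter> B)"
    using assms by (metis card_Int_Diff add.commute Int_commute)
  ultimately show ?thesis by simp
qed

subsection \<open>Colouring the distance graph\<close>

text \<open>\<open>level_coloring\<close> gives the sets smaller than \<open>m - 1\<close> the
  colour \<open>0\<close> from the palette of \<open>c\<close>. That this palette is not empty keeps
  \<open>0\<close> apart from the colours \<open>r\<close> and above.\<close>

lemma johnson_pos:
  assumes "k \<le> n" and "proper_coloring (johnson_graph n k i) r c"
  shows "0 < r"
proof -
  obtain A where "A \<subseteq> {1..n}" "card A = k"
    using obtain_subset_with_card_n[of k "{1..n}"] assms(1) by auto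
  then have "c A < r"
    using assms(2) by (auto simp: proper_coloring_def verts_johnson_graph)
  then show ?thesis by simp
qed

text \<open>The third branch is only reached for sets of size \<open>m + 1\<close> once the parity is fixed.\<close>

definition level_coloring ::
  "nat \<Rightarrow> nat \<Rightarrow> nat \<Rightarrow> (nat set \<Rightarrow> nat) \<Rightarrow> (nat set \<Rightarrow> nat) \<Rightarrow> nat set \<Rightarrow> nat" where
  "level_coloring m r s c d A =
     (if card A < m - 1 then 0
      else if card A = m - 1 then c A
      else if card A \<le> m + 1 then r + d ({1..2 * m + 1} - A)
      else r + s)"

lemma level_coloring_less:
  assumes "m \<ge> 1"
    and c: "proper_coloring (johnson_graph (2 * m + 1) (m - 1) 0) r c"
    and d: "proper_coloring (johnson_graph (2 * m + 1) m 1) s d"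
    and A: "A \<subseteq> {1..2 * m + 1}" "even (card A) = even (m - 1)"
  shows "level_coloring m r s c d A < r + s + 1"
proof -
  have "0 < r" using johnson_pos[OF _ c] by simp
  moreover have "c A < r" if "card A = m - 1"
    using c A that by (auto simp: proper_coloring_def verts_johnson_graph)
  moreover have "d ({1..2 * m + 1} - A) < s" if "card A = m + 1"
  proof -
    have "card ({1..2 * m + 1} - A) = m"
      using A(1) that by (subst card_Diff_subset) (auto intro: finite_subset)
    then show ?thesis
      using d by (auto simp: proper_coloring_def verts_johnson_graph)
  qed
  moreover have "card A \<noteq> m" using A(2) \<open>m \<ge> 1\<close> by auto
  moreover have "card A < m - 1 \<or> card A = m - 1 \<or> card A = m + 1 \<or> card A > m + 1"
    using calculation(4) by linarith
  ultimately show ?thesis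
    by (auto simp: level_coloring_def)
qed

text \<open>Counting with \<open>A\<close> and \<open>B\<close> gives |A| + |B| \<ge> 2m - 2, with
  equality iff they are disjoint. Counting with their complements gives |A| + |B| \<le> 2m + 4.
  Together with the parity of the sizes this settles each possible size of the larger set
  \<open>B\<close>.\<close>

lemma level_coloring_neq_aux:
  assumes m: "m \<ge> 2"
    and c: "proper_coloring (johnson_graph (2 * m + 1) (m - 1) 0) r c"
    and d: "proper_coloring (johnson_graph (2 * m + 1) m 1) s d"
    and A: "A \<subseteq> {1..2 * m + 1}" "even (card A) = even (m - 1)"
    and B: "B \<subseteq> {1..2 * m + 1}" "even (card B) = even (m - 1)"
    and dist: "card (sym_diff A B) = 2 * m - 2"
    and le: "card A \<le> card B"
  shows "level_coloring m r s c d A \<noteq> level_coloring m r s c d B"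
proof -
  let ?U = "{1..2 * m + 1}"
  have fin: "finite A" "finite B" using A(1) B(1) by (auto intro: finite_subset)
  have card_eq: "2 * m - 2 + 2 * card (A \<inter> B) = card A + card B"
    using card_sym_diff[OF fin] dist by simp
  have AB: "A \<noteq> B" using dist m by auto
  have cU: "card (?U - X) = 2 * m + 1 - card X" if "X \<subseteq> ?U" for X
    using that by (subst card_Diff_subset) (auto intro: finite_subset)
  have "sym_diff (?U - A) (?U - B) = sym_diff A B" using A(1) B(1) by auto
  moreover have "finite (?U - A)" "finite (?U - B)" by auto
  ultimately have co_eq: "2 * m - 2 + 2 * card ((?U - A) \<inter> (?U - B))
      = (2 * m + 1 - card A) + (2 * m + 1 - card B)"
    using card_sym_diff[of "?U - A" "?U - B"] dist cU[OF A(1)] cU[OF B(1)] by simp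
  have leU: "card A \<le> 2 * m + 1" "card B \<le> 2 * m + 1"
    using card_mono[OF _ A(1)] card_mono[OF _ B(1)] by auto
  \<comment> \<open>Both sizes have the parity of \<open>m - 1\<close>, so around the middle only
    \<open>m - 1\<close> and \<open>m + 1\<close> survive.\<close>
  have ne: "card A \<noteq> m" "card B \<noteq> m" "card A \<noteq> m + 2" "card B \<noteq> m + 2"
    using A(2) B(2) m by auto
  have r: "0 < r" using johnson_pos[OF _ c] by simp
  have cX: "c X < r" if "X \<subseteq> ?U" "card X = m - 1" for X
    using c that by (auto simp: proper_coloring_def verts_johnson_graph)
  have dX: "d (?U - X) < s" if "X \<subseteq> ?U" "card X = m + 1" for X
    using d that cU[OF that(1)] by (auto simp: proper_coloring_def verts_johnson_graph)
  consider "card B < m - 1" | "card B = m - 1" | "card B = m + 1" | "card B \<ge> m + 3"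
    using ne by linarith
  then show ?thesis
  proof cases
    case 1
    then show ?thesis using card_eq le by linarith
  next
    case 2
    then have "card A = m - 1" "card (A \<inter> B) = 0" using card_eq le m by linarith+
    then have "{A, B} \<in> edges (johnson_graph (2 * m + 1) (m - 1) 0)"
      using 2 A(1) B(1) AB by (simp add: edge_johnson_graph_iff verts_johnson_graph)
    then have "c A \<noteq> c B"
      using c by (auto simp: proper_coloring_def edge_johnson_graph_iff)
    then show ?thesis using 2 \<open>card A = m - 1\<close> by (simp add: level_coloring_def)
  next
    case 3
    have B': "level_coloring m r s c d B = r + d (?U - B)"
      using 3 m unfolding level_coloring_def by auto
    show ?thesis
    proof (cases "card A = m + 1")
      case True
      \<comment> \<open>The complements have size \<open>m\<close> and distance
        \<open>2 * m - 2\<close>, so they share exactly one point.\<close>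
      have "card ((?U - A) \<inter> (?U - B)) = 1" using co_eq True 3 m by linarith
      moreover have "?U - A \<noteq> ?U - B" using AB A(1) B(1) by blast
      moreover have "card (?U - A) = m" "card (?U - B) = m"
        using cU[OF A(1)] cU[OF B(1)] True 3 by auto
      ultimately have "{?U - A, ?U - B} \<in> edges (johnson_graph (2 * m + 1) m 1)"
        unfolding edge_johnson_graph_iff verts_johnson_graph by blast
      then have "d (?U - A) \<noteq> d (?U - B)"
        using d unfolding proper_coloring_def edge_johnson_graph_iff by blast
      moreover have "level_coloring m r s c d A = r + d (?U - A)"
        using True m unfolding level_coloring_def by auto
      ultimately show ?thesis using B' by simp
    next
      case False
      \<comment> \<open>A smaller \<open>A\<close> is coloured below \<open>r\<close>, while the
        colour of \<open>B\<close> is at least \<open>r\<close>.\<close>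
      then have "card A < m" using le 3 ne by linarith
      then show ?thesis using B' r cX[OF A(1)] by (auto simp: level_coloring_def)
    qed
  next
    case 4
    \<comment> \<open>The sizes sum to at most 2m + 4, so only one of the two sets can carry the
      last colour \<open>r + s\<close>.\<close>
    have "card A < m + 2" using co_eq 4 leU le by linarith
    then have "card A < m - 1 \<or> card A = m - 1 \<or> card A = m + 1" using ne by linarith
    then show ?thesis
      using 4 r cX[OF A(1)] dX[OF A(1)] by (auto simp: level_coloring_def)
  qed
qed

lemma level_coloring_neq:
  assumes "m \<ge> 2"
    and "proper_coloring (johnson_graph (2 * m + 1) (m - 1) 0) r c"
    and "proper_coloring (johnson_graph (2 * m + 1) m 1) s d"
    and "A \<subseteq> {1..2 * m + 1}" "even (card A) = even (m - 1)"
    and "B \<subseteq> {1..2 * m + 1}" "even (card B) = even (m - 1)"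
    and dist: "card (sym_diff A B) = 2 * m - 2"
  shows "level_coloring m r s c d A \<noteq> level_coloring m r s c d B"
proof (cases "card A \<le> card B")
  case True
  then show ?thesis using level_coloring_neq_aux[OF assms] by blast
next
  case False
  have "card (sym_diff B A) = 2 * m - 2" using dist by (simp add: Un_commute)
  then show ?thesis
    using level_coloring_neq_aux[OF assms(1-3,6,7,4,5)] False by fastforce
qed

lemma chromatic_number_cube_distance_graph_le:
  assumes m: "m \<ge> 2"
  shows "chromatic_number (cube_distance_graph (2 * m + 1) (2 * m - 2))
    \<le> chromatic_number (johnson_graph (2 * m + 1) (m - 1) 0)
      + chromatic_number (johnson_graph (2 * m + 1) m 1) + 1"
proof -
  let ?G = "cube_distance_graph (2 * m + 1) (2 * m - 2)"
  let ?r = "chromatic_number (johnson_graph (2 * m + 1) (m - 1) 0)"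
  let ?s = "chromatic_number (johnson_graph (2 * m + 1) m 1)"
  let ?U = "{1..2 * m + 1}"
  obtain c where c: "proper_coloring (johnson_graph (2 * m + 1) (m - 1) 0) ?r c"
    using proper_coloring_chromatic_number[OF finite_verts_johnson_graph loopless_johnson_graph]
    by blast
  obtain d where d: "proper_coloring (johnson_graph (2 * m + 1) m 1) ?s d"
    using proper_coloring_chromatic_number[OF finite_verts_johnson_graph loopless_johnson_graph]
    by blast
  define S where "S x = {j \<in> ?U. x j = (1::nat)}" for x
  \<comment> \<open>As \<open>2 * m + 1\<close> is odd, exactly one of \<open>S x\<close> and its
    complement has a size of the parity of \<open>m - 1\<close>.\<close>
  define T where "T x = (if even (card (S x)) = even (m - 1) then S x else ?U - S x)" for x
  have SU: "S x \<subseteq> ?U" for x by (auto simp: S_def)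
  have fin: "finite (S x)" for x by (simp add: S_def)
  have leU: "card (S x) \<le> 2 * m + 1" for x
    using card_mono[OF _ SU[of x]] by simp
  have cU: "card (?U - S x) = 2 * m + 1 - card (S x)" for x
    using card_Diff_subset[OF fin SU, of x] by simp
  have TU: "T x \<subseteq> ?U" for x using SU by (auto simp: T_def)
  have Tpar: "even (card (T x)) = even (m - 1)" for x
    using leU[of x] m cU[of x] unfolding T_def by (cases "even (card (S x)) = even (m - 1)") auto
  have "proper_coloring ?G (?r + ?s + 1) (level_coloring m ?r ?s c d \<circ> T)"
    unfolding proper_coloring_def
  proof (intro conjI ballI impI)
    fix x assume "x \<in> verts ?G"
    then show "(level_coloring m ?r ?s c d \<circ> T) x < ?r + ?s + 1"
      using level_coloring_less[OF _ c d TU Tpar] m by simp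
  next
    fix x y assume x: "x \<in> verts ?G" and y: "y \<in> verts ?G" and e: "{x, y} \<in> edges ?G"
    have "x j \<in> {0, 1}" "y j \<in> {0, 1}" if "j \<in> ?U" for j
      using x y that unfolding verts_cube_distance_graph by (blast dest: PiE_mem)+
    then have "{j \<in> ?U. x j \<noteq> y j} = sym_diff (S x) (S y)"
      by (fastforce simp: S_def)
    then have dist: "card (sym_diff (S x) (S y)) = 2 * m - 2"
      using edge_cube_distance_graphD[OF e] by simp
    \<comment> \<open>An even distance forces equal parities, so \<open>T\<close> complements both
      sets or neither, and the distance survives.\<close>
    have "even (card (S x) + card (S y))"
      unfolding card_sym_diff[OF fin fin, symmetric] dist by simp
    moreover have "sym_diff (?U - S x) (?U - S y) = sym_diff (S x) (S y)"
      using SU[of x] SU[of y] by auto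
    ultimately have "card (sym_diff (T x) (T y)) = 2 * m - 2"
      using dist by (auto simp: T_def)
    then show "(level_coloring m ?r ?s c d \<circ> T) x \<noteq> (level_coloring m ?r ?s c d \<circ> T) y"
      using level_coloring_neq[OF m c d TU Tpar TU Tpar] by simp
  qed
  then show ?thesis by (rule chromatic_number_le)
qed

subsection \<open>Kneser-type graphs\<close>

text \<open>Kneser's colouring by the least element: minima 1, ..., r + 1 get their own colours, and
  all other sets share one. The latter live on the 2k - 1 points from r + 2 to n, where two disjoint
  k-sets do not fit.\<close>

lemma chromatic_number_johnson_graph_0_le:
  assumes "k \<ge> 1" and "n = 2 * k + r"
  shows "chromatic_number (johnson_graph n k 0) \<le> r + 2"
proof -
  define c where "c A = min (Min A - 1) (r + 1)" for A :: "nat set"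
  have "proper_coloring (johnson_graph n k 0) (r + 2) c"
    unfolding proper_coloring_def
  proof (intro conjI ballI impI)
    fix A show "c A < r + 2" by (simp add: c_def)
  next
    fix A B assume "{A, B} \<in> edges (johnson_graph n k 0)"
    then have A: "A \<subseteq> {1..n}" "card A = k" and B: "B \<subseteq> {1..n}" "card B = k"
      and "card (A \<inter> B) = 0"
      by (auto simp: edge_johnson_graph_iff verts_johnson_graph)
    have fin: "finite A" "finite B" using A(1) B(1) by (auto intro: finite_subset)
    have dis: "A \<inter> B = {}" using \<open>card (A \<inter> B) = 0\<close> fin by simp
    have ne: "A \<noteq> {}" "B \<noteq> {}" using A(2) B(2) assms(1) by auto
    have mem: "Min A \<in> A" "Min B \<in> B" using fin ne by auto
    then have pos: "Min A \<ge> 1" "Min B \<ge> 1" using A(1) B(1) by (meson atLeastAtMost_iff subsetD)+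
    have neq: "Min A \<noteq> Min B" using mem dis by auto
    show "c A \<noteq> c B"
    proof
      assume "c A = c B"
      then have "Min A \<ge> r + 2" "Min B \<ge> r + 2"
        using pos neq by (auto simp: c_def min_def split: if_splits)
      then have "A \<union> B \<subseteq> {r + 2..n}"
        using A(1) B(1) Min_le[OF fin(1)] Min_le[OF fin(2)] by (force intro: order_trans)
      then have "card (A \<union> B) \<le> card {r + 2..n}" by (intro card_mono) auto
      moreover have "card (A \<union> B) = 2 * k"
        using card_Un_disjoint[OF fin dis] A(2) B(2) by simp
      ultimately show False using assms by simp
    qed
  qed
  then show ?thesis by (rule chromatic_number_le)
qed

text \<open>Each set must leave the two top points and lose one element in total. A set holding both
  top points loses two and is given one back. Taking the largest missing point ensures that
  \<open>A\<close> contains everything above it, which keeps intersections from growing.\<close>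

definition shrink :: "nat \<Rightarrow> nat set \<Rightarrow> nat set" where
  "shrink n A = (if {n + 1, n + 2} \<subseteq> A then insert (Max ({1..n} - A)) (A - {n + 1, n + 2})
                 else A - {Max A})"

lemma Max_missing:
  assumes "A \<subseteq> {1..n + 2}" and "card A = k + 1" and "k \<le> n" and "{n + 1, n + 2} \<subseteq> A"
  shows "Max ({1..n} - A) \<in> {1..n} - A"
proof (rule Max_in)
  have fin: "finite A" using assms(1) by (rule finite_subset) simp
  show "{1..n} - A \<noteq> {}"
  proof
    assume "{1..n} - A = {}"
    moreover have "{1..n + 2} = {1..n} \<union> {n + 1, n + 2}" by auto
    ultimately have "{1..n + 2} \<subseteq> A" using assms(4) by blast
    then have "n + 2 \<le> card A" using card_mono[OF fin, of "{1..n + 2}"] by simp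
    then show False using assms(2,3) by simp
  qed
qed simp

lemma shrink_subset_card:
  assumes A: "A \<subseteq> {1..n + 2}" "card A = k + 1" and k: "k \<le> n"
  shows "shrink n A \<subseteq> {1..n} \<and> card (shrink n A) = k"
proof -
  have fin: "finite A" using A(1) by (rule finite_subset) simp
  show ?thesis
  proof (cases "{n + 1, n + 2} \<subseteq> A")
    case True
    have x: "Max ({1..n} - A) \<in> {1..n} - A" using Max_missing[OF A k True] .
    have s: "shrink n A = insert (Max ({1..n} - A)) (A - {n + 1, n + 2})"
      using True unfolding shrink_def by (rule if_P)
    have "card (A - {n + 1, n + 2}) = k - 1"
      using card_Diff_subset[OF _ True] A(2) by simp
    moreover have "k \<ge> 1" using card_mono[OF fin True] A(2) by simp
    moreover have "Max ({1..n} - A) \<notin> A - {n + 1, n + 2}" using x by blast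
    ultimately have "card (shrink n A) = k"
      unfolding s using card_insert_disjoint[of "A - {n + 1, n + 2}"] fin by simp
    moreover have "j \<in> {1..n}" if "j \<in> A - {n + 1, n + 2}" for j
    proof -
      have "j \<in> {1..n + 2}" using that A(1) by blast
      then show ?thesis using that by auto
    qed
    then have "shrink n A \<subseteq> {1..n}" unfolding s using x by blast
    ultimately show ?thesis by blast
  next
    case False
    have ne: "A \<noteq> {}" using A(2) by auto
    have M: "Max A \<in> A" using Max_in[OF fin ne] .
    \<comment> \<open>A non-maximal element beyond \<open>n\<close> could only be
      \<open>n + 1\<close> below the maximum \<open>n + 2\<close>, and then \<open>A\<close> would
      contain both top points.\<close>
    have sub: "j \<in> {1..n}" if j: "j \<in> A - {Max A}" for j
    proof (rule ccontr)
      assume "j \<notin> {1..n}"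
      moreover have "j < Max A" using j Max_ge[OF fin, of j] by (simp add: order_less_le)
      moreover have "Max A \<in> {1..n + 2}" "j \<in> {1..n + 2}" using M j A(1) by blast+
      ultimately have "j = n + 1" "Max A = n + 2" unfolding atLeastAtMost_iff by linarith+
      then have "n + 1 \<in> A" "n + 2 \<in> A" using M j by simp_all
      then have "{n + 1, n + 2} \<subseteq> A" by blast
      then show False using False by contradiction
    qed
    have "shrink n A = A - {Max A}" using False unfolding shrink_def by (rule if_not_P)
    moreover have "card (A - {Max A}) = k" using M A(2) fin by simp
    moreover have "A - {Max A} \<subseteq> {1..n}" by (rule subsetI) (rule sub)
    ultimately show ?thesis by simp
  qed
qed

lemma card_shrink_Int_mixed:
  assumes A: "A \<subseteq> {1..n + 2}" "card A = k + 1" and B: "B \<subseteq> {1..n + 2}" "card B = k + 1"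
    and k: "k \<le> n" and AT: "{n + 1, n + 2} \<subseteq> A" and BF: "\<not> {n + 1, n + 2} \<subseteq> B"
  shows "card (shrink n A \<inter> shrink n B) \<le> card (A \<inter> B)"
proof -
  let ?x = "Max ({1..n} - A)"
  have fin: "finite A" "finite B" using A(1) B(1) by (auto intro: finite_subset)
  have sA: "shrink n A = insert ?x (A - {n + 1, n + 2})" using AT by (simp add: shrink_def)
  have sB: "shrink n B = B - {Max B}" using BF by (auto simp: shrink_def)
  show ?thesis
  proof (cases "?x \<in> shrink n B")
    case False
    then have "shrink n A \<inter> shrink n B \<subseteq> A \<inter> B" using sA sB by auto
    then show ?thesis using fin by (intro card_mono) auto
  next
    case True
    \<comment> \<open>The gain of \<open>?x\<close> is paid for by \<open>Max B\<close>: it exceeds \<open>?x\<close> and hence lies in \<open>A\<close>.\<close>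
    then have "?x \<in> B" "?x \<noteq> Max B" using sB by auto
    then have "?x < Max B" using Max_ge[OF fin(2)] by (metis le_neq_implies_less)
    have M: "Max B \<in> B" using fin(2) \<open>?x \<in> B\<close> by (intro Max_in) auto
    have "Max B \<in> A"
    proof (rule ccontr)
      assume "Max B \<notin> A"
      moreover have "Max B \<in> {1..n + 2}" using M B(1) by auto
      ultimately have "Max B \<in> {1..n} - A" using AT by (cases "Max B \<le> n") (auto simp: le_Suc_eq)
      then have "Max B \<le> ?x" by (intro Max_ge) auto
      then show False using \<open>?x < Max B\<close> by simp
    qed
    then have MAB: "Max B \<in> A \<inter> B" using M by blast
    have "shrink n A \<inter> shrink n B \<subseteq> insert ?x (A \<inter> B - {Max B})" using sA sB by auto
    then have "card (shrink n A \<inter> shrink n B) \<le> card (insert ?x (A \<inter> B - {Max B}))"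
      using fin by (intro card_mono) auto
    also have "\<dots> \<le> Suc (card (A \<inter> B - {Max B}))" by (rule card_insert_le_m1) auto
    also have "\<dots> = card (A \<inter> B)" using MAB fin by (intro card_Suc_Diff1) auto
    finally show ?thesis .
  qed
qed

lemma card_shrink_Int_le:
  assumes A: "A \<subseteq> {1..n + 2}" "card A = k + 1" and B: "B \<subseteq> {1..n + 2}" "card B = k + 1"
    and k: "k \<le> n"
  shows "card (shrink n A \<inter> shrink n B) \<le> card (A \<inter> B)"
proof -
  have fin: "finite A" "finite B" using A(1) B(1) by (auto intro: finite_subset)
  consider (both) "{n + 1, n + 2} \<subseteq> A" "{n + 1, n + 2} \<subseteq> B"
    | (left) "{n + 1, n + 2} \<subseteq> A" "\<not> {n + 1, n + 2} \<subseteq> B"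
    | (right) "\<not> {n + 1, n + 2} \<subseteq> A" "{n + 1, n + 2} \<subseteq> B"
    | (neither) "\<not> {n + 1, n + 2} \<subseteq> A" "\<not> {n + 1, n + 2} \<subseteq> B"
    by blast
  then show ?thesis
  proof cases
    case both
    let ?x = "Max ({1..n} - A)" and ?y = "Max ({1..n} - B)" and ?D = "A \<inter> B - {n + 1, n + 2}"
    \<comment> \<open>The intersection loses two common points and gains at most the two inserted
      ones.\<close>
    have sub: "{n + 1, n + 2} \<subseteq> A \<inter> B" using both by auto
    have "card {n + 1, n + 2} \<le> card (A \<inter> B)" using fin by (intro card_mono sub) auto
    then have "card ?D + 2 = card (A \<inter> B)" using card_Diff_subset[OF _ sub] by simp
    moreover have "shrink n A \<inter> shrink n B \<subseteq> {?x, ?y} \<union> ?D"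
      using both by (auto simp: shrink_def)
    then have "card (shrink n A \<inter> shrink n B) \<le> card ({?x, ?y} \<union> ?D)"
      using fin by (intro card_mono) auto
    moreover have "card ({?x, ?y} \<union> ?D) \<le> card {?x, ?y} + card ?D" by (rule card_Un_le)
    moreover have "card {?x, ?y} \<le> 2" by (simp add: card_insert_if)
    ultimately show ?thesis by linarith
  next
    case left
    then show ?thesis using card_shrink_Int_mixed[OF A B k] by blast
  next
    case right
    then show ?thesis using card_shrink_Int_mixed[OF B A k] by (metis Int_commute)
  next
    case neither
    then have "shrink n A \<inter> shrink n B \<subseteq> A \<inter> B" by (auto simp: shrink_def)
    then show ?thesis using fin by (intro card_mono) auto
  qed
qed

lemma chromatic_number_kneser_graph_step:
  assumes "i < k" and "k \<le> n"
  shows "chromatic_number (kneser_graph (n + 2) (k + 1) i) \<le> chromatic_number (kneser_graph n k i)"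
proof (rule chromatic_number_hom_le[where f = "shrink n",
        OF finite_verts_kneser_graph loopless_kneser_graph])
  fix A assume "A \<in> verts (kneser_graph (n + 2) (k + 1) i)"
  then show "shrink n A \<in> verts (kneser_graph n k i)"
    using shrink_subset_card assms(2) by (simp add: verts_kneser_graph)
next
  fix A B assume "{A, B} \<in> edges (kneser_graph (n + 2) (k + 1) i)"
  then have A: "A \<subseteq> {1..n + 2}" "card A = k + 1" and B: "B \<subseteq> {1..n + 2}" "card B = k + 1"
    and i: "card (A \<inter> B) \<le> i"
    unfolding edge_kneser_graph_iff verts_kneser_graph by blast+
  have le: "card (shrink n A \<inter> shrink n B) \<le> i"
    using card_shrink_Int_le[OF A B assms(2)] i by linarith
  have "shrink n A \<subseteq> {1..n} \<and> card (shrink n A) = k" "shrink n B \<subseteq> {1..n} \<and> card (shrink n B) = k"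
    using shrink_subset_card[OF A assms(2)] shrink_subset_card[OF B assms(2)] by blast+
  \<comment> \<open>Equal images would meet in \<open>k\<close> points, more than
    \<open>i\<close>.\<close>
  moreover have "shrink n A \<noteq> shrink n B" using le calculation assms(1) by (metis Int_absorb not_less)
  ultimately show "{shrink n A, shrink n B} \<in> edges (kneser_graph n k i)"
    using le unfolding edge_kneser_graph_iff verts_kneser_graph by blast
qed

lemma chromatic_number_kneser_graph_7_3_1:
  assumes "m \<ge> 3"
  shows "chromatic_number (kneser_graph (2 * m + 1) m 1) \<le> chromatic_number (kneser_graph 7 3 1)"
  using assms
proof (induction m rule: dec_induct)
  case base
  then show ?case by simp
next
  case (step m)
  have "chromatic_number (kneser_graph (2 * m + 1 + 2) (m + 1) 1)
      \<le> chromatic_number (kneser_graph (2 * m + 1) m 1)"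
    using step.hyps by (intro chromatic_number_kneser_graph_step) auto
  then show ?case using step.IH by (simp add: numeral_eq_Suc)
qed

section \<open>The Fano clique and the case of five points\<close>

lemma fano_le_chromatic_number: "7 \<le> chromatic_number (kneser_graph 7 3 1)"
proof -
  \<comment> \<open>The lines of the Fano plane: two distinct ones meet in a single point, hence are
    adjacent in K(7,3,1).\<close>
  let ?F = "{{1, 2, 3}, {1, 4, 5}, {1, 6, 7}, {2, 4, 6}, {2, 5, 7}, {3, 4, 7}, {3, 5, 6}} :: nat set set"
  have V: "A \<in> verts (kneser_graph 7 3 1)" if "A \<in> ?F" for A
  proof -
    have "\<forall>A\<in>?F. A \<subseteq> {1..7} \<and> card A = 3" by simp
    then have "A \<subseteq> {1..7} \<and> card A = 3" using that by (rule bspec)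
    then show ?thesis by (simp add: verts_kneser_graph)
  qed
  have I: "\<forall>A\<in>?F. \<forall>B\<in>?F. A = B \<or> card (A \<inter> B) \<le> 1"
    unfolding ball_simps by (intro conjI TrueI; (rule disjI1, rule refl | rule disjI2, simp))
  \<comment> \<open>The seven lines are told apart by their products.\<close>
  have "(\<lambda>A. \<Prod>A) ` ?F = {6, 20, 42, 48, 70, 84, 90}" by simp
  then have "card ((\<lambda>A. \<Prod>A) ` ?F) = 7" by simp
  then have "7 \<le> card ?F" using card_image_le[of ?F "\<lambda>A. \<Prod>A"] by simp
  moreover have "card ?F \<le> chromatic_number (kneser_graph 7 3 1)"
  proof (rule clique_le_chromatic_number[OF finite_verts_kneser_graph loopless_kneser_graph])
    show "?F \<subseteq> verts (kneser_graph 7 3 1)" by (rule subsetI) (rule V)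
    show "{A, B} \<in> edges (kneser_graph 7 3 1)" if "A \<in> ?F" "B \<in> ?F" "A \<noteq> B" for A B
      using V[OF that(1)] V[OF that(2)] bspec[OF bspec[OF I that(1)] that(2)] that(3)
      unfolding edge_kneser_graph_iff by simp
  qed
  ultimately show ?thesis by simp
qed

text \<open>J(5,2,1) is the line graph of the complete graph on five points. Summing endpoints
  modulo 5 properly colours its edges, since 1, ..., 5 are distinct residues.\<close>

lemma chromatic_number_johnson_graph_5_2_1: "chromatic_number (johnson_graph 5 2 1) \<le> 5"
proof -
  have mod5: "\<forall>x\<in>{1, 2, 3, 4, 5}. \<forall>y\<in>{1, 2, 3, 4, 5}. \<forall>z\<in>{1, 2, 3, 4, 5::nat}.
      (x + y) mod 5 = (x + z) mod 5 \<longrightarrow> y = z"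
    by simp
  have U: "{1..5::nat} = {1, 2, 3, 4, 5}" by auto
  have "proper_coloring (johnson_graph 5 2 1) 5 (\<lambda>A. \<Sum>A mod 5)"
    unfolding proper_coloring_def
  proof (intro conjI ballI impI)
    fix A B assume "{A, B} \<in> edges (johnson_graph 5 2 1)"
    then have A: "A \<subseteq> {1..5}" "card A = 2" and B: "B \<subseteq> {1..5}" "card B = 2"
      and ne: "A \<noteq> B" and AB: "card (A \<inter> B) = 1"
      unfolding edge_johnson_graph_iff verts_johnson_graph by blast+
    obtain x where x: "A \<inter> B = {x}" using AB by (rule card_1_singletonE)
    then have xA: "x \<in> A" and xB: "x \<in> B" by auto
    obtain y where y: "A = {x, y}" "x \<noteq> y" using A(2) xA unfolding card_2_iff by blast
    obtain z where z: "B = {x, z}" "x \<noteq> z" using B(2) xB unfolding card_2_iff by blast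
    have "y \<noteq> z" using ne y z by blast
    moreover have "x \<in> {1..5}" "y \<in> {1..5}" "z \<in> {1..5}" using y z A B by blast+
    ultimately have "(x + y) mod 5 \<noteq> (x + z) mod 5"
      using bspec[OF bspec[OF bspec[OF mod5]], of x y z] unfolding U by metis
    then show "\<Sum>A mod 5 \<noteq> \<Sum>B mod 5" using y z by simp
  qed simp
  then show ?thesis by (rule chromatic_number_le)
qed

text \<open>The case \<open>m = 2\<close> is separate: K(5,2,1) is complete on ten vertices, so
  passing through it would cost ten colours.\<close>

lemma chromatic_number_johnson_graph_1_le:
  assumes "m \<ge> 2"
  shows "chromatic_number (johnson_graph (2 * m + 1) m 1) \<le> chromatic_number (kneser_graph 7 3 1)"
proof (cases "m = 2")
  case True
  then show ?thesis
    using chromatic_number_johnson_graph_5_2_1 fano_le_chromatic_number by simp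
next
  case False
  then show ?thesis
    using assms order_trans[OF johnson_le_kneser chromatic_number_kneser_graph_7_3_1[of m]] by simp
qed

theorem theorem4p17:
  fixes n :: nat
  assumes "n \<ge> 5" and "odd n"
  shows "chromatic_number (cube_distance_graph n (n - 3))
           \<le> chromatic_number (johnson_graph n ((n - 3) div 2) 0)
             + chromatic_number (johnson_graph n ((n - 1) div 2) 1) + 1
       \<and> chromatic_number (johnson_graph n ((n - 3) div 2) 0)
             + chromatic_number (johnson_graph n ((n - 1) div 2) 1) + 1
           \<le> chromatic_number (kneser_graph 7 3 1) + 6"
proof -
  obtain m where n: "n = 2 * m + 1" using \<open>odd n\<close> by (rule oddE)
  then have m: "m \<ge> 2" using \<open>n \<ge> 5\<close> by simp
  have eqs: "n - 3 = 2 * m - 2" "(n - 3) div 2 = m - 1" "(n - 1) div 2 = m" using n m by auto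
  \<comment> \<open>Here n = 2(m - 1) + 3, so the surplus is 3. These five colours and the
    additional one make up the 6.\<close>
  have "chromatic_number (johnson_graph n (m - 1) 0) \<le> 3 + 2"
    by (rule chromatic_number_johnson_graph_0_le) (use n m in auto)
  then show ?thesis
    using chromatic_number_cube_distance_graph_le[OF m] chromatic_number_johnson_graph_1_le[OF m]
    unfolding eqs(2,3) unfolding eqs(1) unfolding n by simp
qed

end
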